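(* Let $a,b,p,q\in\mathbb{Z}$, let $(w_n)_{n\ge 0}$ be the Horadam sequence $w_0=a$, $w_1=b$, $w_n=p\,w_{n-1}+q\,w_{n-2}$ for $n\ge 2$, and let $BH_n=w_n+w_{n+1}i+w_{n+2}j+w_{n+3}k\in\mathbb{BC}$ be the $n$th bicomplex Horadam number. Then the generating function $g(t)=\sum_{n=0}^{\infty}BH_n t^n$ of the bicomplex Horadam numbers is $$g(t)=\frac{BH_0+(BH_1-p\,BH_0)\,t}{1-pt-qt^2}.$$
   Context: $\mathbb{BC}=\{z_1+z_2 j : z_1,z_2\in\mathbb{C}\}$ is the algebra of bicomplex numbers: the commutative associative real algebra with basis $1,i,j,k$, where $i^2=j^2=-1$, $ij=ji=k$, $k^2=1$, $ik=ki=-j$, $jk=kj=-i$. The generating function is understood as a formal power series in $\mathbb{BC}[[t]]$, where $1-pt-qt^2$ is invertible. *)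

theory Defs
  imports Complex_Main "HOL-Computational_Algebra.Formal_Power_Series"
begin

text \<open>\<open>BC z w\<close> stands for the bicomplex number \<open>z + w j\<close>.\<close>

datatype bicomplex = BC (bc_fst: complex) (bc_snd: complex)

lemma bicomplex_eq_iff: "x = y \<longleftrightarrow> bc_fst x = bc_fst y \<and> bc_snd x = bc_snd y"
  by (cases x; cases y) simp

instantiation bicomplex :: comm_ring_1
begin

definition zero_bicomplex :: bicomplex where
  "0 = BC 0 0"

definition one_bicomplex :: bicomplex where
  "1 = BC 1 0"

definition plus_bicomplex :: "bicomplex \<Rightarrow> bicomplex \<Rightarrow> bicomplex" where
  "x + y = BC (bc_fst x + bc_fst y) (bc_snd x + bc_snd y)"

definition uminus_bicomplex :: "bicomplex \<Rightarrow> bicomplex" where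
  "- x = BC (- bc_fst x) (- bc_snd x)"

definition minus_bicomplex :: "bicomplex \<Rightarrow> bicomplex \<Rightarrow> bicomplex" where
  "x - y = BC (bc_fst x - bc_fst y) (bc_snd x - bc_snd y)"

definition times_bicomplex :: "bicomplex \<Rightarrow> bicomplex \<Rightarrow> bicomplex" where
  "x * y = BC (bc_fst x * bc_fst y - bc_snd x * bc_snd y)
              (bc_fst x * bc_snd y + bc_snd x * bc_fst y)"

instance
  by standard
     (simp_all add: zero_bicomplex_def one_bicomplex_def plus_bicomplex_def uminus_bicomplex_def
       minus_bicomplex_def times_bicomplex_def bicomplex_eq_iff algebra_simps)

end

instantiation bicomplex :: real_algebra_1
begin

definition scaleR_bicomplex :: "real \<Rightarrow> bicomplex \<Rightarrow> bicomplex" where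
  "scaleR r x = BC (scaleR r (bc_fst x)) (scaleR r (bc_snd x))"

instance
  by standard
     (simp_all add: scaleR_bicomplex_def plus_bicomplex_def times_bicomplex_def
       bicomplex_eq_iff algebra_simps)

end

text \<open>
  Bicomplex numbers have zero divisors. \<open>z + w j\<close> is a unit iff \<open>z\<^sup>2 + w\<^sup>2 \<noteq> 0\<close>, and then its
  inverse is \<open>(z - w j) / (z\<^sup>2 + w\<^sup>2)\<close>; on non-units the total function below is \<open>0\<close>.
  This instance makes the library's division of formal power series available over \<open>bicomplex\<close>.
\<close>

instantiation bicomplex :: inverse
begin

definition inverse_bicomplex :: "bicomplex \<Rightarrow> bicomplex" where
  "inverse x = BC (bc_fst x / ((bc_fst x)\<^sup>2 + (bc_snd x)\<^sup>2))
                  (- bc_snd x / ((bc_fst x)\<^sup>2 + (bc_snd x)\<^sup>2))"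

definition "x div y = x * inverse y" for x y :: bicomplex

instance ..

end

lemma bicomplex_dvd_1_iff:
  fixes x :: bicomplex
  shows "x dvd 1 \<longleftrightarrow> (bc_fst x)\<^sup>2 + (bc_snd x)\<^sup>2 \<noteq> 0"
proof
  assume "x dvd 1"
  then obtain y where "x * y = 1" by (metis dvdE)
  then have 1: "bc_fst x * bc_fst y - bc_snd x * bc_snd y = 1"
    and 2: "bc_fst x * bc_snd y + bc_snd x * bc_fst y = 0"
    by (simp_all add: times_bicomplex_def one_bicomplex_def)
  have "((bc_fst x)\<^sup>2 + (bc_snd x)\<^sup>2) * ((bc_fst y)\<^sup>2 + (bc_snd y)\<^sup>2)
      = (bc_fst x * bc_fst y - bc_snd x * bc_snd y)\<^sup>2
        + (bc_fst x * bc_snd y + bc_snd x * bc_fst y)\<^sup>2"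
    by (simp add: power2_eq_square algebra_simps)
  also have "\<dots> = 1" using 1 2 by simp
  finally show "(bc_fst x)\<^sup>2 + (bc_snd x)\<^sup>2 \<noteq> 0" by force
next
  assume "(bc_fst x)\<^sup>2 + (bc_snd x)\<^sup>2 \<noteq> 0"
  then have "x * inverse x = 1"
    by (simp add: times_bicomplex_def inverse_bicomplex_def one_bicomplex_def
      diff_divide_distrib[symmetric] add_divide_distrib[symmetric] power2_eq_square)
  then show "x dvd 1" by (metis dvdI)
qed

lemma bicomplex_right_inverse:
  fixes x :: bicomplex
  assumes "x dvd 1"
  shows "x * inverse x = 1"
  using assms unfolding bicomplex_dvd_1_iff
  by (simp add: times_bicomplex_def inverse_bicomplex_def one_bicomplex_def
    diff_divide_distrib[symmetric] add_divide_distrib[symmetric] power2_eq_square)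

lemma inverse_bicomplex_1: "inverse (1 :: bicomplex) = 1"
  using bicomplex_right_inverse[of 1] by simp

text \<open>
  Over this ring, division by a power series with constant term \<open>1\<close> is genuine division by a
  unit of the power series ring.
\<close>

lemma bicomplex_fps_right_inverse:
  fixes f :: "bicomplex fps"
  assumes "fps_nth f 0 = 1"
  shows "f * inverse f = 1"
  unfolding fps_inverse_def
  using fps_right_inverse[of f 1] assms by (simp add: inverse_bicomplex_1)

lemma bicomplex_fps_divide:
  fixes f g :: "bicomplex fps"
  assumes "fps_nth f 0 = 1"
  shows "g / f = g * inverse f"
proof -
  have "subdegree f = 0" using assms by (simp add: subdegree_eq_0_iff)
  then show ?thesis by (simp add: fps_divide_def)
qed

definition bc_i :: bicomplex where
  "bc_i = BC \<i> 0"

definition bc_j :: bicomplex where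
  "bc_j = BC 0 1"

definition bc_k :: bicomplex where
  "bc_k = BC 0 \<i>"

lemma bc_units_mult:
  "bc_i * bc_i = -1" "bc_j * bc_j = -1" "bc_k * bc_k = 1"
  "bc_i * bc_j = bc_k" "bc_j * bc_i = bc_k"
  "bc_i * bc_k = - bc_j" "bc_k * bc_i = - bc_j"
  "bc_j * bc_k = - bc_i" "bc_k * bc_j = - bc_i"
  by (simp_all add: bc_i_def bc_j_def bc_k_def times_bicomplex_def one_bicomplex_def
    uminus_bicomplex_def)

lemma bicomplex_basis:
  "\<exists>!(r, s, t, u). x = r *\<^sub>R 1 + s *\<^sub>R bc_i + t *\<^sub>R bc_j + u *\<^sub>R bc_k"
proof -
  have "x = r *\<^sub>R 1 + s *\<^sub>R bc_i + t *\<^sub>R bc_j + u *\<^sub>R bc_k \<longleftrightarrow>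
      r = Re (bc_fst x) \<and> s = Im (bc_fst x) \<and> t = Re (bc_snd x) \<and> u = Im (bc_snd x)"
    for r s t u
    by (auto simp: bicomplex_eq_iff complex_eq_iff scaleR_bicomplex_def plus_bicomplex_def
      one_bicomplex_def bc_i_def bc_j_def bc_k_def)
  then show ?thesis by auto
qed

fun horadam :: "int \<Rightarrow> int \<Rightarrow> int \<Rightarrow> int \<Rightarrow> nat \<Rightarrow> int" where
  "horadam a b p q 0 = a"
| "horadam a b p q (Suc 0) = b"
| "horadam a b p q (Suc (Suc n)) = p * horadam a b p q (Suc n) + q * horadam a b p q n"

definition bicomplex_horadam :: "int \<Rightarrow> int \<Rightarrow> int \<Rightarrow> int \<Rightarrow> nat \<Rightarrow> bicomplex" where
  "bicomplex_horadam a b p q n =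
     of_int (horadam a b p q n) + of_int (horadam a b p q (n + 1)) * bc_i
     + of_int (horadam a b p q (n + 2)) * bc_j + of_int (horadam a b p q (n + 3)) * bc_k"

end

theory Submission
  imports Defs
begin

text \<open>The components of a bicomplex Horadam number are shifts of one Horadam sequence, so the
  recurrence carries over (\<open>bicomplex_horadam_rec\<close>). Multiplying the series by 1 - pt -
  qt^2 thus kills all coefficients from degree 2 on (\<open>fps_gen_fun_linear_rec2\<close>). This
  factor has constant term 1, so it is a unit and can be divided out.\<close>

lemma bicomplex_horadam_rec:
  "bicomplex_horadam a b p q (Suc (Suc n)) =
    of_int p * bicomplex_horadam a b p q (Suc n) + of_int q * bicomplex_horadam a b p q n"
  by (simp add: bicomplex_horadam_def eval_nat_numeral distrib_left distrib_right mult.assoc)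

lemma fps_gen_fun_linear_rec2:
  fixes f :: "nat \<Rightarrow> 'a :: comm_ring_1" and u v :: 'a
  assumes "\<And>n. f (Suc (Suc n)) = u * f (Suc n) + v * f n"
  shows "Abs_fps f * (1 - fps_const u * fps_X - fps_const v * fps_X ^ 2) =
    fps_const (f 0) + fps_const (f 1 - u * f 0) * fps_X"
proof (rule fps_ext)
  fix n
  \<comment> \<open>With \<open>fps_X\<close> on the left, each product is a coefficient
    shift.\<close>
  have "Abs_fps f * (1 - fps_const u * fps_X - fps_const v * fps_X ^ 2) =
      Abs_fps f - fps_const u * (fps_X * Abs_fps f) - fps_const v * (fps_X * (fps_X * Abs_fps f))"
    by (simp add: right_diff_distrib power2_eq_square mult_ac)
  then show "fps_nth (Abs_fps f * (1 - fps_const u * fps_X - fps_const v * fps_X ^ 2)) n =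
      fps_nth (fps_const (f 0) + fps_const (f 1 - u * f 0) * fps_X) n"
    \<comment> \<open>Degrees 0 and 1 give the initial terms; beyond them the recurrence cancels
      everything.\<close>
    by (cases n; cases "n - 1") (simp_all add: assms)
qed

theorem theorem3p2:
  fixes a b p q :: int
  shows "Abs_fps (bicomplex_horadam a b p q) =
    (fps_const (bicomplex_horadam a b p q 0)
      + fps_const (bicomplex_horadam a b p q 1 - of_int p * bicomplex_horadam a b p q 0) * fps_X)
    / (1 - of_int p * fps_X - of_int q * fps_X ^ 2)"
    (is "?G = ?N / ?D")
proof -
  have "?G * ?D = ?N"
    using fps_gen_fun_linear_rec2[of "bicomplex_horadam a b p q", OF bicomplex_horadam_rec]
    by (simp add: fps_of_int)
  moreover have D0: "fps_nth ?D 0 = 1"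
    by simp
  \<comment> \<open>The coefficient ring has zero divisors, so cancellation rests on
    \<open>?D\<close> being a unit.\<close>
  ultimately have "?N / ?D = ?G * (?D * inverse ?D)"
    using bicomplex_fps_divide[OF D0, of ?N] by (simp only: mult.assoc[symmetric])
  also have "\<dots> = ?G"
    by (simp only: bicomplex_fps_right_inverse[OF D0] mult_1_right)
  finally show ?thesis ..
qed

end
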